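(* For every algebraic computation tree $T$ on $\mathbb{R}^n$, every input $\vec x\in\mathbb{R}^n$ and every integer $k$: $T$ accepts (resp. rejects) $\vec x$ in $k$ steps, i.e. the traversal of $T$ on $\vec x$ reaches a YES (resp. NO) leaf after $k$ steps, if and only if the control state of $[\![T]\!]^k([\![\vec x]\!])$ is $\top$ (resp. $\bot$).
   Context: An algebraic computation tree on $\mathbb{R}^n$ is a binary tree $T$ in which: each vertex $v$ with one child carries an operation $f_v=f_{v_i}\star f_{v_j}$, $f_v=c\star f_{v_i}$ or $f_v=\sqrt{f_{v_i}}$, with $\star\in\{+,-,\times,/\}$, $c\in\mathbb{R}$, and $v_i,v_j$ ancestors of $v$ or input variables $x_1,\dots,x_n$; each vertex with two children carries a test $f_{v_i}\star 0$ with $\star\in\{>,=,\geqslant\}$; each leaf is labelled YES or NO. The traversal on $\vec x$ evaluates operations and follows test outcomes from the root. The translation $[\![T]\!]$: number the internal vertices $n+1,\dots,n+\ell$ (root $n+1$), merge all YES leaves into a state $\top$ and all NO leaves into a state $\bot$. The configuration space is $\mathbb{R}^{\omega}\times\{n+1,\dots,n+\ell,\top,\bot\}$, register $i$ storing $f_{v_i}$ and registers $1,\dots,n$ the inputs. $[\![T]\!]$ is the partial map given by the edges: an operation vertex $i$ with child $t$ gives an edge of source $\mathbb{R}^\omega\times\{i\}$ (restricted to $x_k\neq0$ for a division by register $k$, to $x_k\geqslant0$ for a square root of register $k$) setting register $i$ to the computed value and moving to state $t$; a test vertex $i$ testing $f_{v_k}\star 0$ with children $j$ (true) and $j'$ (false)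 gives two edges of sources $\{x:x_k\star0\}\times\{i\}$ and its complement $\times\{i\}$, identity on registers, moving to $j$, resp. $j'$. The input $\vec x$ is represented by $[\![\vec x]\!]=((x_1,\dots,x_n,0,0,\dots),n+1)$. *)

theory Defs
  imports Complex_Main "HOL-Library.FuncSet" "HOL-Library.Sublist"
begin

datatype binop = Add | Sub | Mul | Div

fun apply_binop :: "binop \<Rightarrow> real \<Rightarrow> real \<Rightarrow> real" where
  "apply_binop Add a b = a + b"
| "apply_binop Sub a b = a - b"
| "apply_binop Mul a b = a * b"
| "apply_binop Div a b = a / b"

text \<open>Operations are polymorphic in the way they name their arguments: in a tree an argument is an
  input variable or an ancestor, in the translation it is a register.\<close>

datatype 'a operation =
    Binary binop 'a 'a
  | ConstBinary binop real 'a  \<comment> \<open>constant on the left\<close>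
  | Sqrt 'a

fun op_value :: "'a operation \<Rightarrow> ('a \<Rightarrow> real) \<Rightarrow> real" where
  "op_value (Binary b u w) \<rho> = apply_binop b (\<rho> u) (\<rho> w)"
| "op_value (ConstBinary b c u) \<rho> = apply_binop b c (\<rho> u)"
| "op_value (Sqrt u) \<rho> = sqrt (\<rho> u)"

text \<open>HOL's division and square root are total, so domains of definition are kept separately.\<close>

fun op_defined :: "'a operation \<Rightarrow> ('a \<Rightarrow> real) \<Rightarrow> bool" where
  "op_defined (Binary b u w) \<rho> \<longleftrightarrow> (b = Div \<longrightarrow> \<rho> w \<noteq> 0)"
| "op_defined (ConstBinary b c u) \<rho> \<longleftrightarrow> (b = Div \<longrightarrow> \<rho> u \<noteq> 0)"
| "op_defined (Sqrt u) \<rho> \<longleftrightarrow> \<rho> u \<ge> 0"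

datatype test = Greater | Equal | GreaterEq

fun test_holds :: "test \<Rightarrow> real \<Rightarrow> bool" where
  "test_holds Greater a \<longleftrightarrow> a > 0"
| "test_holds Equal a \<longleftrightarrow> a = 0"
| "test_holds GreaterEq a \<longleftrightarrow> a \<ge> 0"


text \<open>A vertex of a tree is its path from the root, a list of child positions (starting from 0).
  Hence the ancestors of a vertex are its strict prefixes.\<close>

type_synonym vertex = "nat list"

datatype operand = Input nat | Vertex vertex

datatype answer = YES | NO

datatype tree =
    Leaf answer
  | Compute "operand operation" tree
  | Branch test operand tree tree  \<comment> \<open>child 0: the test holds; child 1: it fails\<close>

fun children :: "tree \<Rightarrow> tree list" where
  "children (Leaf a) = []"
| "children (Compute f t) = [t]"
| "children (Branch s u t t') = [t, t']"

fun subtree :: "tree \<Rightarrow> vertex \<Rightarrow> tree option" where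
  "subtree t [] = Some t"
| "subtree t (d # v) = (if d < length (children t) then subtree (children t ! d) v else None)"

definition internal_vertices :: "tree \<Rightarrow> vertex set" where
  "internal_vertices T = {v. \<exists>t. subtree T v = Some t \<and> children t \<noteq> []}"

definition operation_vertices :: "tree \<Rightarrow> vertex set" where
  "operation_vertices T = {v. \<exists>f t. subtree T v = Some (Compute f t)}"

text \<open>The ancestors referred to must be operation vertices, as test vertices carry no value.\<close>

fun valid_operand :: "nat \<Rightarrow> tree \<Rightarrow> vertex \<Rightarrow> operand \<Rightarrow> bool" where
  "valid_operand n T v (Input i) \<longleftrightarrow> i \<in> {1..n}"
| "valid_operand n T v (Vertex u) \<longleftrightarrow> strict_prefix u v \<and> u \<in> operation_vertices T"

definition computation_tree :: "nat \<Rightarrow> tree \<Rightarrow> bool" where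
  "computation_tree n T \<longleftrightarrow>
     (\<forall>v f t. subtree T v = Some (Compute f t) \<longrightarrow> (\<forall>u \<in> set_operation f. valid_operand n T v u)) \<and>
     (\<forall>v s u t t'. subtree T v = Some (Branch s u t t') \<longrightarrow> valid_operand n T v u)"


text \<open>In \<open>reaches \<rho> v t a k\<close> the traversal stands at vertex \<open>v\<close>, below which hangs \<open>t\<close>; \<open>\<rho>\<close> holds
  the inputs and the values computed so far. A traversal meeting an undefined operation is stuck and
  reaches no leaf.\<close>

inductive reaches :: "(operand \<Rightarrow> real) \<Rightarrow> vertex \<Rightarrow> tree \<Rightarrow> answer \<Rightarrow> nat \<Rightarrow> bool" where
  leaf: "reaches \<rho> v (Leaf a) a 0"
| compute: "reaches \<rho> v (Compute f t) a (Suc k)"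
    if "op_defined f \<rho>" "reaches (\<rho>(Vertex v := op_value f \<rho>)) (v @ [0]) t a k"
| branch_true: "reaches \<rho> v (Branch s u t t') a (Suc k)"
    if "test_holds s (\<rho> u)" "reaches \<rho> (v @ [0]) t a k"
| branch_false: "reaches \<rho> v (Branch s u t t') a (Suc k)"
    if "\<not> test_holds s (\<rho> u)" "reaches \<rho> (v @ [1]) t' a k"

text \<open>Vertices have no value before they are visited.\<close>

fun input_valuation :: "(nat \<Rightarrow> real) \<Rightarrow> operand \<Rightarrow> real" where
  "input_valuation x (Input i) = x i"
| "input_valuation x (Vertex v) = undefined"

definition accepts :: "tree \<Rightarrow> (nat \<Rightarrow> real) \<Rightarrow> nat \<Rightarrow> bool" where
  "accepts T x k \<longleftrightarrow> reaches (input_valuation x) [] T YES k"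

definition rejects :: "tree \<Rightarrow> (nat \<Rightarrow> real) \<Rightarrow> nat \<Rightarrow> bool" where
  "rejects T x k \<longleftrightarrow> reaches (input_valuation x) [] T NO k"


text \<open>Registers are indexed from 1; register 0 is never used.\<close>

datatype state = Ctrl nat | Top | Bot

type_synonym config = "(nat \<Rightarrow> real) \<times> state"

text \<open>An edge is a source together with the map it applies on that source.\<close>

type_synonym edge = "config set \<times> (config \<Rightarrow> config)"

text \<open>Requiring the root to have a number excludes the trees consisting of a single leaf.\<close>

definition numbering :: "nat \<Rightarrow> tree \<Rightarrow> (vertex \<Rightarrow> nat) \<Rightarrow> bool" where
  "numbering n T num \<longleftrightarrow>
     bij_betw num (internal_vertices T) {n + 1..n + card (internal_vertices T)} \<and>
     [] \<in> internal_vertices T \<and> num [] = n + 1"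

fun register :: "(vertex \<Rightarrow> nat) \<Rightarrow> operand \<Rightarrow> nat" where
  "register num (Input i) = i"
| "register num (Vertex v) = num v"

definition state_of :: "(vertex \<Rightarrow> nat) \<Rightarrow> tree \<Rightarrow> vertex \<Rightarrow> state" where
  "state_of num T v =
     (case subtree T v of
        Some (Leaf YES) \<Rightarrow> Top
      | Some (Leaf NO) \<Rightarrow> Bot
      | _ \<Rightarrow> Ctrl (num v))"

definition edges_at :: "(vertex \<Rightarrow> nat) \<Rightarrow> tree \<Rightarrow> vertex \<Rightarrow> edge set" where
  "edges_at num T v =
     (case subtree T v of
        Some (Compute f t) \<Rightarrow>
          let g = map_operation (register num) f in
          {({r. op_defined g r} \<times> {Ctrl (num v)},
            \<lambda>(r, q). (r(num v := op_value g r), state_of num T (v @ [0])))}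
      | Some (Branch s u t t') \<Rightarrow>
          let S = {r. test_holds s (r (register num u))} in
          {(S \<times> {Ctrl (num v)}, \<lambda>(r, q). (r, state_of num T (v @ [0]))),
           ((- S) \<times> {Ctrl (num v)}, \<lambda>(r, q). (r, state_of num T (v @ [1])))}
      | _ \<Rightarrow> {})"

definition edges :: "(vertex \<Rightarrow> nat) \<Rightarrow> tree \<Rightarrow> edge set" where
  "edges num T = (\<Union>v \<in> internal_vertices T. edges_at num T v)"

text \<open>The description is meaningful only if no configuration is sent to two different ones; for
  \<open>edges num T\<close> with \<open>num\<close> a numbering, this holds as distinct edges have disjoint sources.\<close>

definition partial_map :: "edge set \<Rightarrow> config \<rightharpoonup> config" where
  "partial_map E c =
     (if \<exists>(S, \<phi>) \<in> E. c \<in> S then Some (THE c'. \<exists>(S, \<phi>) \<in> E. c \<in> S \<and> c' = \<phi> c) else None)"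

definition translation :: "(vertex \<Rightarrow> nat) \<Rightarrow> tree \<Rightarrow> config \<rightharpoonup> config" where
  "translation num T = partial_map (edges num T)"

definition iterate :: "nat \<Rightarrow> ('a \<rightharpoonup> 'a) \<Rightarrow> 'a \<rightharpoonup> 'a" where
  "iterate k f c = ((\<lambda>d. Option.bind d f) ^^ k) (Some c)"

definition encode_input :: "nat \<Rightarrow> (nat \<Rightarrow> real) \<Rightarrow> config" where
  "encode_input n x = ((\<lambda>i. if i \<in> {1..n} then x i else 0), Ctrl (n + 1))"

abbreviation control_state :: "config \<Rightarrow> state" where
  "control_state \<equiv> snd"

end

(* The traversal of T and the iteration of its translation run in lockstep: the valuation of the
   traversal at a vertex v and the registers of the machine agree on the inputs and on the operation
   vertices above v, which are all that an operation or a test at v may read. A step at v writes only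
   register num v; as the numbering is injective with values above n, this is neither an input nor the
   register of an ancestor. The states \<top> and \<bot> have no outgoing edge, so the number of steps is
   exact. *)
theory Submission
  imports Defs
begin

lemma iterate_0 [simp]: "iterate 0 f c = Some c"
  by (simp add: iterate_def)

text \<open>Peels off the first step, not the last, because \<open>reaches\<close> recurses from the
  root downwards. It rests on \<open>None\<close> being a fixed point of the lifted map.\<close>

lemma iterate_Suc: "iterate (Suc k) f c = Option.bind (f c) (iterate k f)"
proof -
  have "((\<lambda>d. Option.bind d f) ^^ k) None = None"
    by (induction k) simp_all
  then show ?thesis
    by (cases "f c") (simp_all only: iterate_def funpow_Suc_right comp_apply Option.bind.simps)
qed

lemma partial_map_eq_None: "\<not> (\<exists>(S, \<phi>) \<in> E. c \<in> S) \<Longrightarrow> partial_map E c = None"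
  by (simp only: partial_map_def if_False)

text \<open>Edges whose source misses \<open>c\<close> affect neither the domain test nor the
  definite description.\<close>

lemma partial_map_cong:
  assumes "\<And>S \<phi>. c \<in> S \<Longrightarrow> (S, \<phi>) \<in> E \<longleftrightarrow> (S, \<phi>) \<in> E'"
  shows "partial_map E c = partial_map E' c"
proof -
  have "(\<exists>(S, \<phi>) \<in> E. c \<in> S) \<longleftrightarrow> (\<exists>(S, \<phi>) \<in> E'. c \<in> S)"
    using assms by blast
  moreover have "(\<exists>(S, \<phi>) \<in> E. c \<in> S \<and> c' = \<phi> c) \<longleftrightarrow> (\<exists>(S, \<phi>) \<in> E'. c \<in> S \<and> c' = \<phi> c)" for c'
    using assms by blast
  ultimately show ?thesis
    by (simp only: partial_map_def)
qed

lemma subtree_append: "subtree t (v @ w) = Option.bind (subtree t v) (\<lambda>s. subtree s w)"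
  by (induction v arbitrary: t) auto

lemma op_value_cong:
  "(\<And>u. u \<in> set_operation f \<Longrightarrow> \<rho> u = r (g u)) \<Longrightarrow> op_value (map_operation g f) r = op_value f \<rho>"
  by (cases f) auto

lemma op_defined_cong:
  "(\<And>u. u \<in> set_operation f \<Longrightarrow> \<rho> u = r (g u)) \<Longrightarrow> op_defined (map_operation g f) r = op_defined f \<rho>"
  by (cases f) auto

inductive_simps reaches_Leaf_iff: "reaches \<rho> v (Leaf b) a k"
inductive_simps reaches_Compute_iff: "reaches \<rho> v (Compute f t) a k"
inductive_simps reaches_Branch_iff: "reaches \<rho> v (Branch s u t t') a k"

lemma edges_at_source: "(S, \<phi>) \<in> edges_at num T v \<Longrightarrow> c \<in> S \<Longrightarrow> snd c = Ctrl (num v)"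
  by (auto simp: edges_at_def Let_def split: option.splits tree.splits)

text \<open>Injectivity of \<open>num\<close> on internal vertices excludes the edges of every other
  vertex, so the definite description has to be evaluated only over the edges at
  \<open>v\<close>.\<close>

lemma translation_Ctrl:
  assumes "numbering n T num" "v \<in> internal_vertices T"
  shows "translation num T (r, Ctrl (num v)) = partial_map (edges_at num T v) (r, Ctrl (num v))"
  unfolding translation_def
proof (rule partial_map_cong)
  fix S \<phi> assume S: "(r, Ctrl (num v)) \<in> S"
  have "w = v" if "w \<in> internal_vertices T" "(S, \<phi>) \<in> edges_at num T w" for w
    using edges_at_source[OF that(2) S] assms that(1)
    by (auto simp: numbering_def bij_betw_def dest: inj_onD)
  then show "(S, \<phi>) \<in> edges num T \<longleftrightarrow> (S, \<phi>) \<in> edges_at num T v"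
    using assms(2) by (auto simp: edges_def)
qed

lemma translation_final: "translation num T (r, Top) = None" "translation num T (r, Bot) = None"
  by (auto simp: translation_def edges_def intro!: partial_map_eq_None dest!: edges_at_source)

lemma translation_Compute:
  assumes "numbering n T num" "subtree T v = Some (Compute f t)"
  defines "g \<equiv> map_operation (register num) f"
  shows "translation num T (r, Ctrl (num v)) =
    (if op_defined g r then Some (r(num v := op_value g r), state_of num T (v @ [0])) else None)"
proof -
  have "v \<in> internal_vertices T"
    using assms(2) by (auto simp: internal_vertices_def)
  moreover have "edges_at num T v = {({r. op_defined g r} \<times> {Ctrl (num v)},
      \<lambda>(r, q). (r(num v := op_value g r), state_of num T (v @ [0])))}"
    using assms(2) by (simp add: edges_at_def g_def Let_def)
  ultimately show ?thesis
    by (auto simp: translation_Ctrl[OF assms(1)] partial_map_def)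
qed

text \<open>The two sources at \<open>v\<close> are complementary, so exactly one edge applies and a
  test never gets stuck.\<close>

lemma translation_Branch:
  assumes "numbering n T num" "subtree T v = Some (Branch s u t t')"
  shows "translation num T (r, Ctrl (num v)) =
    Some (r, state_of num T (v @ [if test_holds s (r (register num u)) then 0 else 1]))"
proof -
  let ?S = "{r. test_holds s (r (register num u))}"
  have "v \<in> internal_vertices T"
    using assms(2) by (auto simp: internal_vertices_def)
  moreover have "edges_at num T v =
      {(?S \<times> {Ctrl (num v)}, \<lambda>(r, q). (r, state_of num T (v @ [0]))),
       ((- ?S) \<times> {Ctrl (num v)}, \<lambda>(r, q). (r, state_of num T (v @ [1])))}"
    using assms(2) by (simp add: edges_at_def Let_def)
  ultimately show ?thesis
    by (auto simp: translation_Ctrl[OF assms(1)] partial_map_def)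
qed

text \<open>The invariant of the simulation. Agreement on all operands cannot be asked for: at an
  unvisited vertex the valuation is arbitrary, while initially its register holds 0.\<close>

definition agree where
  "agree n T num v \<rho> r \<longleftrightarrow> (\<forall>u. valid_operand n T v u \<longrightarrow> \<rho> u = r (register num u))"

text \<open>The strict prefixes of \<open>v @ [d]\<close> are \<open>v\<close> and its strict
  prefixes, so a descent adds at most one operand.\<close>

lemma valid_operand_snoc:
  "valid_operand n T (v @ [d]) u \<Longrightarrow> valid_operand n T v u \<or> u = Vertex v \<and> v \<in> operation_vertices T"
  by (cases u) (auto simp: strict_prefix_def)

lemma operation_vertices_subset: "operation_vertices T \<subseteq> internal_vertices T"
  by (auto simp: operation_vertices_def internal_vertices_def)

lemma register_neq_num:
  assumes "numbering n T num" "v \<in> internal_vertices T" "valid_operand n T v u"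
  shows "register num u \<noteq> num v"
proof (cases u)
  case (Input i)
  have "num v \<in> {n + 1..n + card (internal_vertices T)}"
    using assms(1,2) by (auto simp: numbering_def bij_betw_def)
  then show ?thesis
    using Input assms(3) by auto
next
  case (Vertex w)
  then have "w \<noteq> v" "w \<in> internal_vertices T"
    using assms(3) operation_vertices_subset by (auto simp: strict_prefix_def)
  then show ?thesis
    using Vertex assms(1,2) by (auto simp: numbering_def bij_betw_def dest: inj_onD)
qed

lemma agree_Compute:
  assumes "numbering n T num" "v \<in> internal_vertices T" "agree n T num v \<rho> r"
  shows "agree n T num (v @ [d]) (\<rho>(Vertex v := y)) (r(num v := y))"
  using assms(3) register_neq_num[OF assms(1,2)]
  by (auto simp: agree_def strict_prefix_def dest!: valid_operand_snoc)

text \<open>A test vertex is no operation vertex, so the descent makes no new operand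
  available.\<close>

lemma agree_Branch:
  assumes "subtree T v = Some (Branch s u t t')" "agree n T num v \<rho> r"
  shows "agree n T num (v @ [d]) \<rho> r"
  using assms by (auto simp: agree_def operation_vertices_def dest!: valid_operand_snoc)

text \<open>Lets one induction treat acceptance and rejection together.\<close>

fun answer_state :: "answer \<Rightarrow> state" where
  "answer_state YES = Top"
| "answer_state NO = Bot"

text \<open>Generalised from the root to any vertex, so that structural induction on the subtree
  \<open>t\<close> applies; this yields both directions at once.\<close>

lemma reaches_iff_iterate:
  assumes "computation_tree n T" "numbering n T num"
    and "subtree T v = Some t" "agree n T num v \<rho> r"
  shows "reaches \<rho> v t a k \<longleftrightarrow>
    map_option control_state (iterate k (translation num T) (r, state_of num T v)) =
      Some (answer_state a)"
  using assms(3,4)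
proof (induction t arbitrary: v \<rho> r k)
  case (Leaf b)
  have "state_of num T v = answer_state b"
    using Leaf.prems(1) by (cases b) (simp_all add: state_of_def)
  then show ?case
    \<comment> \<open>For \<open>k = 0\<close> both sides say \<open>a = b\<close>; for larger
      \<open>k\<close> both are false, since a final state has no successor.\<close>
    by (cases k; cases a; cases b) (simp_all add: reaches_Leaf_iff iterate_Suc translation_final)
next
  case (Compute f t)
  let ?g = "map_operation (register num) f"
  have "\<forall>u \<in> set_operation f. valid_operand n T v u"
    using assms(1) Compute.prems(1) by (auto simp: computation_tree_def)
  then have *: "\<rho> u = r (register num u)" if "u \<in> set_operation f" for u
    using that Compute.prems(2) by (simp add: agree_def)
  have val: "op_value ?g r = op_value f \<rho>" and dfd: "op_defined ?g r = op_defined f \<rho>"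
    by (rule op_value_cong op_defined_cong, erule *)+
  have "v \<in> internal_vertices T"
    using Compute.prems(1) by (auto simp: internal_vertices_def)
  with assms(2) Compute.prems(2)
  have agree: "agree n T num (v @ [0]) (\<rho>(Vertex v := op_value f \<rho>)) (r(num v := op_value f \<rho>))"
    by (blast intro: agree_Compute)
  have child: "subtree T (v @ [0]) = Some t"
    using Compute.prems(1) by (simp add: subtree_append)
  have state: "state_of num T v = Ctrl (num v)"
    using Compute.prems(1) by (simp add: state_of_def)
  show ?case
  proof (cases k)
    case 0
    \<comment> \<open>Both sides are false: an internal vertex has a \<open>Ctrl\<close> state and
      no traversal ends there.\<close>
    then show ?thesis
      using state by (cases a) (simp_all add: reaches_Compute_iff)
  next
    case (Suc m)
    \<comment> \<open>If the operation is undefined, both sides are false: no rule of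
      \<open>reaches\<close> applies and the machine halts without a configuration.\<close>
    then show ?thesis
      using Compute.IH[OF child agree, of m]
      by (simp add: reaches_Compute_iff iterate_Suc state val dfd
          translation_Compute[OF assms(2) Compute.prems(1)] del: fun_upd_apply)
  qed
next
  case (Branch s u t t')
  have "valid_operand n T v u"
    using assms(1) Branch.prems(1) by (auto simp: computation_tree_def)
  then have u: "r (register num u) = \<rho> u"
    using Branch.prems(2) by (simp add: agree_def)
  have agree: "agree n T num (v @ [d]) \<rho> r" for d
    using Branch.prems by (rule agree_Branch)
  have children: "subtree T (v @ [0]) = Some t" "subtree T (v @ [1]) = Some t'"
    using Branch.prems(1) by (simp_all add: subtree_append)
  have state: "state_of num T v = Ctrl (num v)"
    using Branch.prems(1) by (simp add: state_of_def)
  show ?case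
  proof (cases k)
    case 0
    then show ?thesis
      using state by (cases a) (simp_all add: reaches_Branch_iff)
  next
    case (Suc m)
    then show ?thesis
      using Branch.IH(1)[OF children(1) agree] Branch.IH(2)[OF children(2) agree]
      by (simp add: reaches_Branch_iff iterate_Suc state u
          translation_Branch[OF assms(2) Branch.prems(1)])
  qed
qed

theorem theorem3:
  fixes n k :: nat and T :: tree and num :: "vertex \<Rightarrow> nat" and x :: "nat \<Rightarrow> real"
  assumes "computation_tree n T"
    and "numbering n T num"
    and "x \<in> {1..n} \<rightarrow>\<^sub>E UNIV"
  shows "(accepts T x k \<longleftrightarrow>
           map_option control_state (iterate k (translation num T) (encode_input n x)) = Some Top) \<and>
         (rejects T x k \<longleftrightarrow>
           map_option control_state (iterate k (translation num T) (encode_input n x)) = Some Bot)"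
proof -
  let ?r = "\<lambda>i. if i \<in> {1..n} then x i else 0"
  \<comment> \<open>The root has no strict prefix, so only the inputs \<open>1..n\<close> are valid
    operands there.\<close>
  have "valid_operand n T [] u \<Longrightarrow> input_valuation x u = ?r (register num u)" for u
    by (cases u) auto
  then have agree: "agree n T num [] (input_valuation x) ?r"
    by (simp add: agree_def)
  \<comment> \<open>A numbering requires the root to be internal, which rules out a single
    leaf.\<close>
  have "state_of num T [] = Ctrl (n + 1)"
    using assms(2)
    by (cases T) (auto simp: state_of_def numbering_def internal_vertices_def)
  then have "encode_input n x = (?r, state_of num T [])"
    by (simp add: encode_input_def)
  then show ?thesis
    unfolding accepts_def rejects_def
    using reaches_iff_iterate[OF assms(1,2) _ agree, of T _ k] by simp
qed

end
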